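(* Let $J$ be a Jacobi matrix with parameters $a_n>0$, $b_n\in\mathbb{R}$ satisfying $a_n\to1$, $b_n\to0$. Fix $z_0\in\mathbb{D}$ such that $z_0+z_0^{-1}$ is not an eigenvalue of $J$. Then Szegő asymptotics holds at $z_0$ (that is, $z^n p_n(z+\tfrac1z)$ evaluated at $z=z_0$ has a finite nonzero limit as $n\to\infty$) if and only if Jost asymptotics holds at $z_0$ (that is, $z^{-n}w_n(z)$ evaluated at $z=z_0$ has a finite nonzero limit as $n\to\infty$).
   Context: $\mathbb{D}=\{z\in\mathbb{C}: |z|<1\}$. $J$ is the bounded selfadjoint operator on $\ell^2(\{1,2,\dots\})$ given by the tridiagonal matrix with diagonal entries $J_{nn}=b_n$ and off-diagonal entries $J_{n,n+1}=J_{n+1,n}=a_n$ ($n\ge1$); $\{\delta_n\}$ is the standard basis. The orthonormal polynomials are defined by $p_{-1}=0$, $p_0=1$, $x p_n(x)=a_{n+1}p_{n+1}(x)+b_{n+1}p_n(x)+a_n p_{n-1}(x)$ ($n\ge0$). The Weyl solution is $w_n(z)=\langle\delta_n,(z+z^{-1}-J)^{-1}\delta_1\rangle$ for $z\in\mathbb{D}$ with $z+z^{-1}$ not an eigenvalue of $J$. Conventions at $z=0$: $z^np_n(z+1/z)$ is a polynomial in $z$, and $z^{-n}w_n(z)$ has a removable singularity at $z=0$; the values at $z=0$ are the resulting ones (and $z=0$ is regarded as satisfying the non-eigenvalue condition). *)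

theory Defs
  imports "HOL-Analysis.Analysis" "HOL-Computational_Algebra.Polynomial"
begin

text \<open>
  Sequences indexed by \<open>{1,2,\<dots>}\<close> are functions on \<^typ>\<open>nat\<close>. The parameters \<open>a 0\<close> and \<open>b 0\<close> are
  never used, and elements of \<open>\<ell>\<^sup>2({1,2,\<dots>})\<close> are normalised to vanish at the dummy index 0, so that
  equality of functions is equality in \<open>\<ell>\<^sup>2\<close>.
\<close>

definition ell2 :: "(nat \<Rightarrow> complex) set" where
  "ell2 = {u. u 0 = 0 \<and> (\<lambda>n. (cmod (u n))\<^sup>2) summable_on {1..}}"

definition ell2_inner :: "(nat \<Rightarrow> complex) \<Rightarrow> (nat \<Rightarrow> complex) \<Rightarrow> complex" where
  "ell2_inner u v = (\<Sum>\<^sub>\<infinity>n\<in>{1..}. cnj (u n) * v n)"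

definition delta :: "nat \<Rightarrow> nat \<Rightarrow> complex" where
  "delta n = (\<lambda>k. if k = n then 1 else 0)"

definition jacobi_matrix :: "(nat \<Rightarrow> real) \<Rightarrow> (nat \<Rightarrow> real) \<Rightarrow> nat \<Rightarrow> nat \<Rightarrow> real" where
  "jacobi_matrix a b m n =
     (if m = n then b n
      else if n = Suc m then a m
      else if m = Suc n then a n
      else 0)"

definition jacobi_op ::
    "(nat \<Rightarrow> real) \<Rightarrow> (nat \<Rightarrow> real) \<Rightarrow> (nat \<Rightarrow> complex) \<Rightarrow> (nat \<Rightarrow> complex)" where
  "jacobi_op a b u =
     (\<lambda>m. if m = 0 then 0
          else (\<Sum>\<^sub>\<infinity>n\<in>{1..}. complex_of_real (jacobi_matrix a b m n) * u n))"

definition jacobi_eigenvalue :: "(nat \<Rightarrow> real) \<Rightarrow> (nat \<Rightarrow> real) \<Rightarrow> complex \<Rightarrow> bool" where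
  "jacobi_eigenvalue a b E \<longleftrightarrow>
     (\<exists>u\<in>ell2. u \<noteq> (\<lambda>n. 0) \<and> jacobi_op a b u = (\<lambda>n. E * u n))"

text \<open>
  The inverse of \<open>E - J\<close> as a map of \<open>\<ell>\<^sup>2\<close>. When \<open>J\<close> is bounded and \<open>E - J\<close> is a bijection of
  \<open>\<ell>\<^sup>2\<close>, this inverse is automatically bounded. For \<open>a\<^sub>n \<rightarrow> 1\<close>, \<open>b\<^sub>n \<rightarrow> 0\<close> the essential spectrum of \<open>J\<close> is
  \<open>[-2,2]\<close>, so \<open>E - J\<close> is a bijection for every \<open>E = z + 1/z\<close> with \<open>0 < |z| < 1\<close> that is
  not an eigenvalue.
\<close>

definition jacobi_resolvent ::
    "(nat \<Rightarrow> real) \<Rightarrow> (nat \<Rightarrow> real) \<Rightarrow> complex \<Rightarrow> (nat \<Rightarrow> complex) \<Rightarrow> (nat \<Rightarrow> complex)" where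
  "jacobi_resolvent a b E = the_inv_into ell2 (\<lambda>u n. E * u n - jacobi_op a b u n)"

definition weyl :: "(nat \<Rightarrow> real) \<Rightarrow> (nat \<Rightarrow> real) \<Rightarrow> nat \<Rightarrow> complex \<Rightarrow> complex" where
  "weyl a b n z = ell2_inner (delta n) (jacobi_resolvent a b (z + inverse z) (delta 1))"

fun orth_poly :: "(nat \<Rightarrow> real) \<Rightarrow> (nat \<Rightarrow> real) \<Rightarrow> nat \<Rightarrow> complex poly" where
  "orth_poly a b 0 = 1"
| "orth_poly a b (Suc 0) =
     smult (inverse (complex_of_real (a 1))) [:- complex_of_real (b 1), 1:]"
| "orth_poly a b (Suc (Suc n)) =
     smult (inverse (complex_of_real (a (n + 2))))
       ([:- complex_of_real (b (n + 2)), 1:] * orth_poly a b (n + 1)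
        - smult (complex_of_real (a (n + 1))) (orth_poly a b n))"

lemma orth_poly_recurrence:
  assumes "a (n + 1) > 0"
  shows "x * poly (orth_poly a b n) x =
           complex_of_real (a (n + 1)) * poly (orth_poly a b (n + 1)) x
           + complex_of_real (b (n + 1)) * poly (orth_poly a b n) x
           + (if n = 0 then 0
              else complex_of_real (a n) * poly (orth_poly a b (n - 1)) x)"
  using assms by (cases n) (simp_all add: field_simps)

text \<open>
  The functions \<open>z\<^sup>n p\<^sub>n(z + 1/z)\<close> and \<open>z\<^sup>-\<^sup>n w\<^sub>n(z)\<close>. Both have a removable singularity at
  \<open>z = 0\<close>; the value there is the limit (the formulas themselves would give junk, as \<open>inverse 0 = 0\<close>).
\<close>

definition szego_fun :: "(nat \<Rightarrow> real) \<Rightarrow> (nat \<Rightarrow> real) \<Rightarrow> nat \<Rightarrow> complex \<Rightarrow> complex" where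
  "szego_fun a b n z =
     (let f = (\<lambda>z. z ^ n * poly (orth_poly a b n) (z + inverse z))
      in if z = 0 then Lim (at 0) f else f z)"

definition jost_fun :: "(nat \<Rightarrow> real) \<Rightarrow> (nat \<Rightarrow> real) \<Rightarrow> nat \<Rightarrow> complex \<Rightarrow> complex" where
  "jost_fun a b n z =
     (let f = (\<lambda>z. z powi (- int n) * weyl a b n z)
      in if z = 0 then Lim (at 0) f else f z)"

definition szego_asymptotics_at :: "(nat \<Rightarrow> real) \<Rightarrow> (nat \<Rightarrow> real) \<Rightarrow> complex \<Rightarrow> bool" where
  "szego_asymptotics_at a b z \<longleftrightarrow> (\<exists>L. L \<noteq> 0 \<and> (\<lambda>n. szego_fun a b n z) \<longlonglongrightarrow> L)"

definition jost_asymptotics_at :: "(nat \<Rightarrow> real) \<Rightarrow> (nat \<Rightarrow> real) \<Rightarrow> complex \<Rightarrow> bool" where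
  "jost_asymptotics_at a b z \<longleftrightarrow> (\<exists>L. L \<noteq> 0 \<and> (\<lambda>n. jost_fun a b n z) \<longlonglongrightarrow> L)"

end

theory Submission
  imports Defs
begin

text \<open>
  Write \<open>E = z + 1/z\<close>. The diagonal entries of the resolvent of \<open>J\<close> are \<open>g\<^sub>n = p\<^sub>n\<^sub>-\<^sub>1(E) w\<^sub>n(z)\<close>. As \<open>a\<^sub>n \<rightarrow> 1\<close>
  and \<open>b\<^sub>n \<rightarrow> 0\<close>, the matrix looks like the free one near the site \<open>n\<close>, and \<open>g\<^sub>n\<close> tends to the free value
  \<open>z / (1 - z\<^sup>2)\<close>. Since
  \<open>z\<^sup>n p\<^sub>n(E) \<cdot> z\<^sup>-\<^sup>n\<^sup>-\<^sup>1 w\<^sub>n\<^sub>+\<^sub>1(z) = g\<^sub>n\<^sub>+\<^sub>1 / z\<close>, the product of the Szego and (shifted) Jost sequences tends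
  to \<open>1 / (1 - z\<^sup>2) \<noteq> 0\<close>, and so one of them has a finite nonzero limit if and only if the other has
  (\<open>tendsto_nonzero_iff_cofactor\<close>).

  The convergence of \<open>g\<^sub>n\<close> is elementary. The Riccati recursion
  \<open>r\<^sub>n = a\<^sub>n / (E - b\<^sub>n\<^sub>+\<^sub>1 - a\<^sub>n\<^sub>+\<^sub>1 r\<^sub>n\<^sub>+\<^sub>1)\<close> for the ratios of a solution is, read backward, a perturbation of a map with
  the attracting fixed point \<open>z\<close>; a contraction argument gives ratios with \<open>r\<^sub>n \<rightarrow> z\<close>
  (\<open>riccati_ratios_tendsto\<close>) and thus a geometrically decaying solution. If \<open>E\<close> is not an eigenvalue, this
  solution does not vanish at 0, and normalised there it is the Weyl solution (\<open>weyl_eq_decaying_solution\<close>). The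
  constancy of its Wronskian with the orthonormal polynomials turns into a first-order affine recursion for \<open>g\<^sub>n\<close> with
  multiplier \<open>r\<^sub>n\<^sup>2 \<rightarrow> z\<^sup>2\<close>, whose limit can be read off (\<open>szego_jost_product_tendsto\<close>).

  At \<open>z = 0\<close> both sequences are explicit: the values are \<open>1 / (a\<^sub>1 \<dots> a\<^sub>n)\<close> and \<open>a\<^sub>1 \<dots> a\<^sub>n\<^sub>-\<^sub>1\<close>, by the recurrence
  (\<open>szego_fun_0\<close>) and by the same Riccati recursion for large \<open>E\<close> (\<open>jost_fun_0\<close>), so the product is 1.
\<close>

section \<open>Perturbed contractions\<close>

lemma contraction_error_tendsto_0:
  fixes x \<eta> :: "nat \<Rightarrow> real"
  assumes q: "0 \<le> q" "q < 1" and x0: "\<And>n. 0 \<le> x n"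
    and step: "\<forall>\<^sub>F n in sequentially. x (Suc n) \<le> q * x n + \<eta> n"
    and \<eta>: "\<eta> \<longlonglongrightarrow> 0"
  shows "x \<longlonglongrightarrow> 0"
proof (rule LIMSEQ_I)
  fix \<epsilon> :: real assume \<epsilon>: "\<epsilon> > 0"
  have "\<forall>\<^sub>F n in sequentially. \<eta> n < \<epsilon> / 2 * (1 - q)"
    using order_tendstoD(2)[OF \<eta>, of "\<epsilon> / 2 * (1 - q)"] q \<epsilon> by simp
  with step have "\<forall>\<^sub>F n in sequentially. x (Suc n) \<le> q * x n + \<epsilon> / 2 * (1 - q)"
    by eventually_elim linarith
  then obtain N where N: "\<And>n. n \<ge> N \<Longrightarrow> x (Suc n) \<le> q * x n + \<epsilon> / 2 * (1 - q)"
    unfolding eventually_sequentially by blast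
  have bd: "x (N + k) \<le> q ^ k * x N + \<epsilon> / 2" for k
  proof (induction k)
    case (Suc k)
    have "x (N + Suc k) \<le> q * x (N + k) + \<epsilon> / 2 * (1 - q)" using N[of "N + k"] by simp
    also have "\<dots> \<le> q * (q ^ k * x N + \<epsilon> / 2) + \<epsilon> / 2 * (1 - q)"
      using Suc q by (intro add_right_mono mult_left_mono) auto
    finally show ?case by (simp add: field_simps)
  qed (use \<epsilon> in simp)
  have "(\<lambda>k. q ^ k * x N) \<longlonglongrightarrow> 0 * x N"
    using q by (intro tendsto_intros LIMSEQ_realpow_zero) auto
  from order_tendstoD(2)[OF this, of "\<epsilon> / 2"] \<epsilon>
  have "\<forall>\<^sub>F k in sequentially. q ^ k * x N < \<epsilon> / 2" by simp
  then obtain M where "\<And>k. k \<ge> M \<Longrightarrow> q ^ k * x N < \<epsilon> / 2" by (auto simp: eventually_sequentially)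
  then have "x (N + k) < \<epsilon>" if "k \<ge> M" for k
    using bd[of k] that by fastforce
  then have "x n < \<epsilon>" if "n \<ge> N + M" for n
    using that by (metis add_leD1 le_add_diff_inverse nat_add_left_cancel_le)
  then show "\<exists>no. \<forall>n\<ge>no. norm (x n - 0) < \<epsilon>" using x0 by (intro exI[of _ "N + M"]) auto
qed

text \<open>
  A recursion \<open>g\<^sub>n\<^sub>+\<^sub>1 = c\<^sub>n g\<^sub>n + d\<^sub>n\<close> whose multiplier tends to a limit inside the unit disc forgets its
  initial value. With \<open>L = d'/(1 - c')\<close> the fixed point of the limiting recursion, the error \<open>g\<^sub>n - L\<close> is
  contracted at each step, up to a perturbation \<open>c\<^sub>n L + d\<^sub>n - L\<close> that tends to 0.
\<close>

lemma affine_recursion_tendsto: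
  fixes g c d :: "nat \<Rightarrow> complex"
  assumes c: "c \<longlonglongrightarrow> c'" "cmod c' < 1" and d: "d \<longlonglongrightarrow> d'"
    and step: "\<forall>\<^sub>F n in sequentially. g (Suc n) = c n * g n + d n"
  shows "g \<longlonglongrightarrow> d' / (1 - c')"
proof -
  define L where "L = d' / (1 - c')"
  have c1: "c' \<noteq> 1" using c(2) by auto
  then have L: "c' * L + d' - L = 0" unfolding L_def by (simp add: divide_simps) (simp add: algebra_simps)
  obtain q where q: "cmod c' < q" "q < 1" using c(2) dense by blast
  have "(\<lambda>n. c n * L + d n - L) \<longlonglongrightarrow> c' * L + d' - L" by (intro tendsto_intros c d)
  then have \<eta>: "(\<lambda>n. cmod (c n * L + d n - L)) \<longlonglongrightarrow> 0"
    unfolding L by (rule tendsto_norm_zero)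
  have "\<forall>\<^sub>F n in sequentially. cmod (c n) < q"
    using order_tendstoD(2)[OF tendsto_norm[OF c(1)] q(1)] .
  then have "\<forall>\<^sub>F n in sequentially.
      cmod (g (Suc n) - L) \<le> q * cmod (g n - L) + cmod (c n * L + d n - L)"
    using step
  proof eventually_elim
    case (elim n)
    have "g (Suc n) - L = c n * (g n - L) + (c n * L + d n - L)"
      using elim by (simp add: algebra_simps)
    then have "cmod (g (Suc n) - L) \<le> cmod (c n) * cmod (g n - L) + cmod (c n * L + d n - L)"
      by (metis norm_mult norm_triangle_ineq)
    also have "\<dots> \<le> q * cmod (g n - L) + cmod (c n * L + d n - L)"
      using elim by (intro add_right_mono mult_right_mono) auto
    finally show ?case .
  qed
  then have "(\<lambda>n. cmod (g n - L)) \<longlonglongrightarrow> 0"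
    using q(2) order.strict_implies_order[OF order.strict_trans1[OF norm_ge_zero q(1)]]
    by (intro contraction_error_tendsto_0[OF _ _ _ _ \<eta>]) auto
  then show ?thesis
    using LIM_zero_cancel[OF tendsto_norm_zero_cancel] by (simp add: L_def)
qed

text \<open>
  The contraction runs from \<open>n + 1\<close> to \<open>n\<close>, and the uniform bound \<open>B\<close> serves as the initial value: starting
  \<open>k\<close> steps to the right of \<open>n\<close> bounds \<open>x\<^sub>n\<close> by \<open>q\<^sup>k B\<close> plus a small error, and \<open>k\<close> is arbitrary.
\<close>

lemma backward_contraction_error_tendsto_0:
  fixes x \<eta> :: "nat \<Rightarrow> real"
  assumes q: "0 \<le> q" "q < 1" and x0: "\<And>n. 0 \<le> x n" and xB: "\<And>n. x n \<le> B"
    and step: "\<forall>\<^sub>F n in sequentially. x n \<le> q * x (Suc n) + \<eta> n"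
    and \<eta>: "\<eta> \<longlonglongrightarrow> 0"
  shows "x \<longlonglongrightarrow> 0"
proof (rule LIMSEQ_I)
  fix \<epsilon> :: real assume \<epsilon>: "\<epsilon> > 0"
  have "\<forall>\<^sub>F n in sequentially. \<eta> n < \<epsilon> / 2 * (1 - q)"
    using order_tendstoD(2)[OF \<eta>, of "\<epsilon> / 2 * (1 - q)"] q \<epsilon> by simp
  with step have "\<forall>\<^sub>F n in sequentially. x n \<le> q * x (Suc n) + \<epsilon> / 2 * (1 - q)"
    by eventually_elim linarith
  then obtain N where N: "\<And>n. n \<ge> N \<Longrightarrow> x n \<le> q * x (Suc n) + \<epsilon> / 2 * (1 - q)"
    unfolding eventually_sequentially by blast
  have bd: "x n \<le> q ^ k * B + \<epsilon> / 2" if "n \<ge> N" for n k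
    using that
  proof (induction k arbitrary: n)
    case (Suc k)
    have "x n \<le> q * x (Suc n) + \<epsilon> / 2 * (1 - q)" using N Suc.prems by simp
    also have "\<dots> \<le> q * (q ^ k * B + \<epsilon> / 2) + \<epsilon> / 2 * (1 - q)"
      using Suc q by (intro add_right_mono mult_left_mono) auto
    finally show ?case by (simp add: field_simps)
  qed (use \<epsilon> xB in \<open>auto intro: add_increasing2\<close>)
  have "(\<lambda>k. q ^ k * B + \<epsilon> / 2) \<longlonglongrightarrow> 0 * B + \<epsilon> / 2"
    using q by (intro tendsto_intros LIMSEQ_realpow_zero) auto
  then have "x n \<le> \<epsilon> / 2" if "n \<ge> N" for n
    using bd[OF that] LIMSEQ_le_const by fastforce
  then have "x n < \<epsilon>" if "n \<ge> N" for n using that \<epsilon> by fastforce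
  then show "\<exists>no. \<forall>n\<ge>no. norm (x n - 0) < \<epsilon>" using x0 by (intro exI[of _ N]) auto
qed

text \<open>
  The orbit is the limit of \<open>F\<^sub>n (F\<^sub>n\<^sub>+\<^sub>1 (\<dots> F\<^sub>n\<^sub>+\<^sub>j\<^sub>-\<^sub>1 (x\<^sub>0)))\<close> as \<open>j \<rightarrow> \<infinity>\<close>. Two such compositions that agree in their
  first \<open>j\<close> maps differ by at most \<open>\<kappa>\<^sup>j\<close> times the diameter of \<open>K\<close>, which makes the sequence Cauchy. For
  fractional linear maps this is the convergence of a continued fraction.
\<close>

lemma backward_orbit_exists:
  fixes F :: "nat \<Rightarrow> 'a :: metric_space \<Rightarrow> 'a"
  assumes K: "complete K" "bounded K" "K \<noteq> {}"
    and \<kappa>: "0 \<le> \<kappa>" "\<kappa> < 1"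
    and maps: "\<And>n x. x \<in> K \<Longrightarrow> F n x \<in> K"
    and contr: "\<And>n x y. x \<in> K \<Longrightarrow> y \<in> K \<Longrightarrow> dist (F n x) (F n y) \<le> \<kappa> * dist x y"
  obtains r where "\<And>n. r n \<in> K" "\<And>n. r n = F n (r (Suc n))"
proof -
  obtain x0 where x0: "x0 \<in> K" using K(3) by blast
  define s where "s = rec_nat (\<lambda>n. x0) (\<lambda>j t n. F n (t (Suc n)))"
  have s0: "s 0 n = x0" and sS: "s (Suc j) n = F n (s j (Suc n))" for j n by (auto simp: s_def)
  have sK: "s j n \<in> K" for j n by (induction j arbitrary: n) (auto simp: s0 sS x0 maps)
  obtain D where D: "\<And>x y. x \<in> K \<Longrightarrow> y \<in> K \<Longrightarrow> dist x y \<le> D"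
    using K(2) by (meson bounded_two_points)
  have close: "dist (s (j + i) n) (s j n) \<le> \<kappa> ^ j * D" for i j n
  proof (induction j arbitrary: n)
    case (Suc j)
    have "dist (s (Suc j + i) n) (s (Suc j) n) \<le> \<kappa> * dist (s (j + i) (Suc n)) (s j (Suc n))"
      by (simp add: sS contr sK)
    also have "\<dots> \<le> \<kappa> * (\<kappa> ^ j * D)" by (intro mult_left_mono Suc \<kappa>)
    finally show ?case by (simp add: mult.assoc)
  qed (simp add: D sK)
  have "\<exists>l\<in>K. (\<lambda>j. s j n) \<longlonglongrightarrow> l" for n
  proof -
    have "Cauchy (\<lambda>j. s j n)"
    proof (rule CauchyI')
      fix e :: real assume e: "e > 0"
      have "(\<lambda>j. \<kappa> ^ j * D) \<longlonglongrightarrow> 0 * D"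
        using \<kappa> by (intro tendsto_intros LIMSEQ_realpow_zero) auto
      from order_tendstoD(2)[OF this, of e] e
      have "\<forall>\<^sub>F j in sequentially. \<kappa> ^ j * D < e" by simp
      then obtain M where M: "\<And>j. j \<ge> M \<Longrightarrow> \<kappa> ^ j * D < e" by (auto simp: eventually_sequentially)
      show "\<exists>M. \<forall>m\<ge>M. \<forall>k>m. dist (s m n) (s k n) < e"
      proof (intro exI allI impI)
        fix m k assume "m \<ge> M" "k > m"
        then show "dist (s m n) (s k n) < e"
          using close[of m "k - m" n] M[of m] by (simp add: dist_commute)
      qed
    qed
    then show ?thesis using completeE[OF K(1), of "\<lambda>j. s j n"] sK by metis
  qed
  then have "\<forall>n. \<exists>l. l \<in> K \<and> (\<lambda>j. s j n) \<longlonglongrightarrow> l" by blast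
  from choice[OF this] obtain r
    where r: "\<And>n. r n \<in> K" "\<And>n. (\<lambda>j. s j n) \<longlonglongrightarrow> r n" by blast
  have "r n = F n (r (Suc n))" for n
  proof (rule LIMSEQ_unique)
    show "(\<lambda>j. s (Suc j) n) \<longlonglongrightarrow> r n" by (rule LIMSEQ_Suc[OF r(2)])
    have "dist (s (Suc j) n) (F n (r (Suc n))) \<le> dist (s j (Suc n)) (r (Suc n))" for j
    proof -
      have "dist (s (Suc j) n) (F n (r (Suc n))) \<le> \<kappa> * dist (s j (Suc n)) (r (Suc n))"
        unfolding sS by (rule contr[OF sK r(1)])
      also have "\<dots> \<le> 1 * dist (s j (Suc n)) (r (Suc n))"
        using \<kappa> by (intro mult_right_mono) auto
      finally show ?thesis by simp
    qed
    then show "(\<lambda>j. s (Suc j) n) \<longlonglongrightarrow> F n (r (Suc n))"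
      by (intro metric_tendsto_imp_tendsto[OF r(2)[of "Suc n"]] always_eventually allI)
  qed
  with r(1) show ?thesis by (rule that)
qed

lemma backward_extension:
  fixes G :: "nat \<Rightarrow> 'a \<Rightarrow> 'a \<Rightarrow> 'a"
  assumes "\<And>n. n \<ge> N \<Longrightarrow> u n = G n (u (Suc n)) (u (Suc (Suc n)))"
  shows "\<exists>v. (\<forall>n\<ge>N. v n = u n) \<and> (\<forall>n. v n = G n (v (Suc n)) (v (Suc (Suc n))))"
  using assms
proof (induction N arbitrary: u)
  case 0
  have "\<forall>n. u n = G n (u (Suc n)) (u (Suc (Suc n)))" by (intro allI 0) simp
  then show ?case by blast
next
  case (Suc N)
  define u' where "u' = u(N := G N (u (Suc N)) (u (Suc (Suc N))))"
  have "u' n = G n (u' (Suc n)) (u' (Suc (Suc n)))" if "n \<ge> N" for n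
  proof (cases "n = N")
    case True
    then show ?thesis by (simp add: u'_def)
  next
    case False
    then have "u n = G n (u (Suc n)) (u (Suc (Suc n)))" using that by (intro Suc.prems) simp
    with False that show ?thesis by (simp only: u'_def fun_upd_apply) simp
  qed
  from Suc.IH[of u', OF this] obtain v
    where v: "\<forall>n\<ge>N. v n = u' n" "\<forall>n. v n = G n (v (Suc n)) (v (Suc (Suc n)))" by blast
  have "\<forall>n\<ge>Suc N. v n = u n" using v(1) by (simp add: u'_def)
  with v(2) show ?case by blast
qed

lemma tendsto_nonzero_iff_cofactor:
  fixes x y :: "nat \<Rightarrow> complex"
  assumes "(\<lambda>n. x n * y (Suc n)) \<longlonglongrightarrow> c" "c \<noteq> 0"
  shows "(\<exists>L. L \<noteq> 0 \<and> x \<longlonglongrightarrow> L) \<longleftrightarrow> (\<exists>L. L \<noteq> 0 \<and> y \<longlonglongrightarrow> L)"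
proof -
  have cof: "v \<longlonglongrightarrow> c / L" if "u \<longlonglongrightarrow> L" "L \<noteq> 0" "(\<lambda>n. u n * v n) \<longlonglongrightarrow> c"
    for u v :: "nat \<Rightarrow> complex" and L
  proof (rule Lim_transform_eventually)
    show "(\<lambda>n. u n * v n / u n) \<longlonglongrightarrow> c / L" by (intro tendsto_divide that)
    show "\<forall>\<^sub>F n in sequentially. u n * v n / u n = v n"
      using tendsto_imp_eventually_ne[OF that(1,2)] by eventually_elim simp
  qed
  show ?thesis
  proof safe
    fix L assume "L \<noteq> 0" "x \<longlonglongrightarrow> L"
    then have "(\<lambda>n. y (Suc n)) \<longlonglongrightarrow> c / L" using cof[of x L "\<lambda>n. y (Suc n)"] assms(1) by simp
    then show "\<exists>L. L \<noteq> 0 \<and> y \<longlonglongrightarrow> L"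
      using \<open>L \<noteq> 0\<close> assms(2) by (intro exI[of _ "c / L"]) (simp add: filterlim_sequentially_Suc)
  next
    fix L assume L: "L \<noteq> 0" "y \<longlonglongrightarrow> L"
    have "x \<longlonglongrightarrow> c / L"
      using assms(1) by (intro cof[OF LIMSEQ_Suc[OF L(2)] L(1)]) (simp add: mult.commute)
    then show "\<exists>L. L \<noteq> 0 \<and> x \<longlonglongrightarrow> L" using L assms(2) by (intro exI[of _ "c / L"]) simp
  qed
qed

section \<open>Solutions of the Jacobi recurrence and the resolvent\<close>

text \<open>
  The index 0 is a boundary site, joined to site 1 by the coupling \<open>a\<^sub>0\<close>. With \<open>a(0 := 1)\<close> for
  \<open>a\<close>, a square-summable solution with \<open>u\<^sub>0 = 0\<close> satisfies \<open>J u = E u\<close>, and one with \<open>u\<^sub>0 = 1\<close> satisfies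
  \<open>(E - J) u = \<delta>\<^sub>1\<close> on the positive indices.
\<close>

definition jacobi_solution ::
    "(nat \<Rightarrow> real) \<Rightarrow> (nat \<Rightarrow> real) \<Rightarrow> complex \<Rightarrow> (nat \<Rightarrow> complex) \<Rightarrow> bool" where
  "jacobi_solution a b E u \<longleftrightarrow>
     (\<forall>n. a (Suc n) * u (Suc (Suc n)) + b (Suc n) * u (Suc n) + a n * u n = E * u (Suc n))"

text \<open>
  The weighted Wronskian of two solutions does not depend on \<open>n\<close>: multiply the equation of each
  solution by the other one and subtract; the terms with \<open>E\<close> and \<open>b\<close> cancel.
\<close>

lemma jacobi_solution_wronskian:
  assumes u: "jacobi_solution a b E u" and v: "jacobi_solution a b E v"
  shows "a n * (u (Suc n) * v n - u n * v (Suc n)) = a 0 * (u 1 * v 0 - u 0 * v 1)"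
proof (induction n)
  case (Suc n)
  have "a (Suc n) * u (Suc (Suc n)) = E * u (Suc n) - b (Suc n) * u (Suc n) - a n * u n"
       "a (Suc n) * v (Suc (Suc n)) = E * v (Suc n) - b (Suc n) * v (Suc n) - a n * v n"
    using u v unfolding jacobi_solution_def by (metis add_diff_cancel_right' add_diff_cancel_left' add.commute diff_diff_add)+
  then have "a (Suc n) * (u (Suc (Suc n)) * v (Suc n) - u (Suc n) * v (Suc (Suc n)))
      = a n * (u (Suc n) * v n - u n * v (Suc n))"
    by algebra
  with Suc show ?case by simp
qed simp

lemma jacobi_solution_eq_0:
  assumes u: "jacobi_solution a b E u" and "u 0 = 0" "u 1 = 0" and a: "\<And>n. a (Suc n) \<noteq> 0"
  shows "u n = 0"
proof -
  have "u n = 0 \<and> u (Suc n) = 0"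
  proof (induction n)
    case (Suc n)
    have "a (Suc n) * u (Suc (Suc n)) = 0"
      using u[unfolded jacobi_solution_def, rule_format, of n] Suc by simp
    with Suc a show ?case by simp
  qed (use assms in auto)
  then show ?thesis by simp
qed

lemma infsum_finite_support:
  assumes "finite F" "F \<subseteq> A" "\<And>x. x \<in> A - F \<Longrightarrow> f x = 0"
  shows "infsum f A = sum f F"
  using infsum_cong_neutral[of A F f f] assms by (simp add: Int_absorb1 Diff_eq_empty_iff[THEN iffD2])


text \<open>
  For a vector normalised to vanish at 0, the dummy coupling can be given the value 1, so that the first
  row of the matrix looks like all the others.
\<close>

lemma jacobi_op_Suc:
  assumes "u 0 = 0"
  shows "jacobi_op a b u (Suc n) =
    a (Suc n) * u (Suc (Suc n)) + b (Suc n) * u (Suc n) + complex_of_real ((a(0 := 1)) n) * u n"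
proof -
  have "jacobi_op a b u (Suc n) = (\<Sum>\<^sub>\<infinity>k\<in>{1..}. complex_of_real (jacobi_matrix a b (Suc n) k) * u k)"
    by (simp add: jacobi_op_def)
  also have "\<dots> = (\<Sum>k\<in>{n, Suc n, Suc (Suc n)} - {0}. complex_of_real (jacobi_matrix a b (Suc n) k) * u k)"
    by (rule infsum_finite_support) (auto simp: jacobi_matrix_def)
  also have "\<dots> = (\<Sum>k\<in>{n, Suc n, Suc (Suc n)}. complex_of_real (jacobi_matrix a b (Suc n) k) * u k)"
    by (rule sum.mono_neutral_left) (auto simp: assms)
  also have "\<dots> = a (Suc n) * u (Suc (Suc n)) + b (Suc n) * u (Suc n) + complex_of_real ((a(0 := 1)) n) * u n"
    by (auto simp: jacobi_matrix_def assms)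
  finally show ?thesis .
qed

lemma ell2_bounded:
  assumes "u \<in> ell2"
  obtains B where "\<And>n. cmod (u n) \<le> B"
proof -
  have s: "(\<lambda>n. (cmod (u n))\<^sup>2) summable_on {1..}" and u0: "u 0 = 0" using assms by (auto simp: ell2_def)
  have "(cmod (u n))\<^sup>2 \<le> (\<Sum>\<^sub>\<infinity>n\<in>{1..}. (cmod (u n))\<^sup>2)" if "n \<ge> 1" for n
    using finite_sum_le_infsum[OF s, of "{n}"] that by simp
  moreover have "(cmod (u 0))\<^sup>2 \<le> (\<Sum>\<^sub>\<infinity>n\<in>{1..}. (cmod (u n))\<^sup>2)"
    by (simp add: u0 infsum_nonneg)
  ultimately have "(cmod (u n))\<^sup>2 \<le> (\<Sum>\<^sub>\<infinity>n\<in>{1..}. (cmod (u n))\<^sup>2)" for n by (cases "n = 0") auto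
  then show ?thesis using that real_le_rsqrt by blast
qed

lemma geometric_decay_imp_ell2:
  assumes q: "q < 1" and "\<And>n. n \<ge> N \<Longrightarrow> cmod (u (Suc n)) \<le> q * cmod (u n)"
  shows "u(0 := 0) \<in> ell2" "u \<longlonglongrightarrow> 0"
proof -
  have "summable u" by (rule summable_ratio_test[OF q, of N]) (rule assms(2))
  then show u0: "u \<longlonglongrightarrow> 0" by (rule summable_LIMSEQ_zero)
  have sn: "summable (\<lambda>n. cmod (u n))" 
    by (rule summable_ratio_test[OF q, of N]) (use assms(2) in simp)
  have "\<forall>\<^sub>F n in sequentially. norm ((cmod (u n))\<^sup>2) \<le> cmod (u n)"
  proof -
    have "\<forall>\<^sub>F n in sequentially. cmod (u n) < 1"
      using order_tendstoD(2)[OF tendsto_norm[OF u0], of 1] by simp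
    then show ?thesis by eventually_elim (simp add: power2_eq_square mult_left_le)
  qed
  then have "summable (\<lambda>n. (cmod (u n))\<^sup>2)" by (rule summable_comparison_test_ev[OF _ sn])
  then have "(\<lambda>n. (cmod (u n))\<^sup>2) summable_on UNIV"
    by (simp add: summable_on_UNIV_nonneg_real_iff)
  then have "(\<lambda>n. (cmod (u n))\<^sup>2) summable_on {1..}"
    using summable_on_subset_banach by blast
  moreover have "(\<lambda>n. (cmod ((u(0:=0)) n))\<^sup>2) summable_on {1..} \<longleftrightarrow> (\<lambda>n. (cmod (u n))\<^sup>2) summable_on {1..}"
    by (rule summable_on_cong) auto
  ultimately show "u(0 := 0) \<in> ell2" by (auto simp: ell2_def)
qed

text \<open>
  The restriction of \<open>w\<close> to positive indices solves \<open>(E - J) h = \<delta>\<^sub>1\<close>, since the missing term of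
  the first row is \<open>w\<^sub>0 = 1\<close>. It remains to see that \<open>E - J\<close> is injective, for then \<open>h\<close> is the value of the
  resolvent. The difference \<open>d\<close> of two vectors with the same image solves the recurrence with
  \<open>d\<^sub>0 = 0\<close>, so that its Wronskian with \<open>w\<close> equals \<open>d\<^sub>1\<close>. As \<open>d\<close> is bounded and \<open>w\<close> tends to 0, the Wronskian is 0.
  The existence of a decaying solution with \<open>w\<^sub>0 \<noteq> 0\<close> thus excludes eigenvalues.
\<close>

lemma weyl_eq_decaying_solution:
  assumes a: "\<And>n. n \<ge> 1 \<Longrightarrow> a n > 0" and bd: "\<And>n. a n \<le> A"
    and w: "jacobi_solution (a(0 := 1)) b (z + inverse z) w" "w 0 = 1"
    and w2: "w(0 := 0) \<in> ell2" and lim: "w \<longlonglongrightarrow> 0" and n: "n \<ge> 1"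
  shows "weyl a b n z = w n"
proof -
  define E where "E = z + inverse z"
  define f where "f = (\<lambda>u n. E * u n - jacobi_op a b u n)"
  define h where "h = w(0 := 0)"
  have f0: "f u 0 = 0" if "u \<in> ell2" for u using that by (simp add: f_def jacobi_op_def ell2_def)
  have fh: "f h = delta 1"
  proof
    fix k show "f h k = delta 1 k"
    proof (cases k)
      case 0 then show ?thesis using f0[of h] w2 by (simp add: h_def delta_def)
    next
      case (Suc j)
      then show ?thesis
        using w(1)[unfolded jacobi_solution_def, rule_format, of j] w(2)
        by (cases j) (auto simp: f_def h_def delta_def jacobi_op_Suc E_def [symmetric] algebra_simps)
    qed
  qed
  have inj: "inj_on f ell2"
  proof (rule inj_onI)
    fix u v assume uv: "u \<in> ell2" "v \<in> ell2" "f u = f v"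
    have u0: "u 0 = 0" and v0: "v 0 = 0" using uv by (auto simp: ell2_def)
    define d where "d = (\<lambda>n. u n - v n)"
    have d: "jacobi_solution (a(0 := 1)) b E d"
      unfolding jacobi_solution_def
    proof
      fix n
      have "E * u (Suc n) - jacobi_op a b u (Suc n) = E * v (Suc n) - jacobi_op a b v (Suc n)"
        using fun_cong[OF uv(3), of "Suc n"] by (simp add: f_def)
      then show "(a(0 := 1)) (Suc n) * d (Suc (Suc n)) + b (Suc n) * d (Suc n) + (a(0 := 1)) n * d n
          = E * d (Suc n)"
        by (auto simp: jacobi_op_Suc[of u, OF u0] jacobi_op_Suc[of v, OF v0] d_def algebra_simps)
    qed
    obtain B C where BC: "\<And>n. cmod (u n) \<le> B" "\<And>n. cmod (v n) \<le> C"
      using ell2_bounded uv by metis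
    have dB: "cmod (d n) \<le> B + C" for n
      unfolding d_def using BC[of n] norm_triangle_ineq4[of "u n" "v n"] by linarith
    have B0: "0 \<le> B + C" using order_trans[OF norm_ge_zero dB] .
    have W: "a n * (d (Suc n) * w n - d n * w (Suc n)) = d 1" if "n \<ge> 1" for n
      using jacobi_solution_wronskian[OF d w(1)[folded E_def], of n] that w(2) u0 v0 by (simp add: d_def)
    have "(\<lambda>n. A * ((B + C) * cmod (w n) + (B + C) * cmod (w (Suc n)))) \<longlonglongrightarrow>
        A * ((B + C) * cmod 0 + (B + C) * cmod 0)"
      by (intro tendsto_intros lim LIMSEQ_Suc)
    moreover have "cmod (d 1) \<le> A * ((B + C) * cmod (w n) + (B + C) * cmod (w (Suc n)))" if "n \<ge> 1" for n
    proof -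
      have "cmod (d 1) = a n * cmod (d (Suc n) * w n - d n * w (Suc n))"
        using a[OF that] by (subst W[OF that, symmetric]) (simp add: norm_mult)
      also have "\<dots> \<le> A * (cmod (d (Suc n) * w n) + cmod (d n * w (Suc n)))"
        using a[OF that] bd[of n] by (intro mult_mono norm_triangle_ineq4) auto
      also have "\<dots> \<le> A * ((B + C) * cmod (w n) + (B + C) * cmod (w (Suc n)))"
        unfolding norm_mult using a[OF that] bd[of n]
        by (intro mult_left_mono add_mono mult_right_mono dB) auto
      finally show ?thesis .
    qed
    ultimately have "cmod (d 1) \<le> 0" using LIMSEQ_le_const by fastforce
    then have "d n = 0" for n
      using jacobi_solution_eq_0[OF d] a u0 v0 by (simp add: d_def less_imp_neq[symmetric])
    then show "u = v" by (auto simp: d_def)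
  qed
  have res: "jacobi_resolvent a b E (delta 1) = h"
    unfolding jacobi_resolvent_def f_def[symmetric]
    using the_inv_into_f_f[OF inj w2] unfolding h_def[symmetric] fh .
  have "ell2_inner (delta n) h = (\<Sum>k\<in>{n}. cnj (delta n k) * h k)"
    unfolding ell2_inner_def using n by (intro infsum_finite_support) (auto simp: delta_def)
  also have "\<dots> = w n" using n by (simp add: delta_def h_def)
  finally show ?thesis using res by (simp add: weyl_def E_def)
qed

section \<open>Decaying solutions from the Riccati recursion\<close>

text \<open>
  The difference of the two quotients is \<open>c \<alpha> (x - y)\<close> over the product of the denominators.
\<close>

lemma dist_fractional_linear_le:
  fixes c e \<alpha> x y :: complex
  assumes m: "m > 0" and x: "m \<le> cmod (e - \<alpha> * x)" and y: "m \<le> cmod (e - \<alpha> * y)"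
    and \<kappa>: "cmod c * cmod \<alpha> \<le> \<kappa> * m\<^sup>2"
  shows "dist (c / (e - \<alpha> * x)) (c / (e - \<alpha> * y)) \<le> \<kappa> * dist x y"
proof -
  have nz: "e - \<alpha> * x \<noteq> 0" "e - \<alpha> * y \<noteq> 0" using m x y by auto
  have m2: "m\<^sup>2 \<le> cmod (e - \<alpha> * x) * cmod (e - \<alpha> * y)"
    unfolding power2_eq_square using m by (intro mult_mono x y) auto
  have "c / (e - \<alpha> * x) - c / (e - \<alpha> * y) = c * \<alpha> * (x - y) / ((e - \<alpha> * x) * (e - \<alpha> * y))"
    using nz by (simp add: divide_simps) (simp add: algebra_simps)
  then have "dist (c / (e - \<alpha> * x)) (c / (e - \<alpha> * y))
      = cmod c * cmod \<alpha> * cmod (x - y) / (cmod (e - \<alpha> * x) * cmod (e - \<alpha> * y))"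
    by (simp add: dist_norm norm_mult norm_divide)
  also have "\<dots> \<le> cmod c * cmod \<alpha> * cmod (x - y) / m\<^sup>2"
    using m m2 by (intro divide_left_mono) (auto intro!: mult_pos_pos simp: nz)
  also have "\<dots> \<le> \<kappa> * m\<^sup>2 * cmod (x - y) / m\<^sup>2"
    by (intro divide_right_mono mult_right_mono \<kappa>) auto
  also have "\<dots> = \<kappa> * dist x y" using m by (simp add: dist_norm)
  finally show ?thesis .
qed

lemma fractional_linear_backward_orbit:
  fixes c e \<alpha> :: "nat \<Rightarrow> complex" and x0 :: complex
  assumes m: "m > 0" and \<rho>: "\<rho> \<ge> 0" and \<kappa>: "0 \<le> \<kappa>" "\<kappa> < 1"
    and den: "\<And>n x. x \<in> cball x0 \<rho> \<Longrightarrow> m \<le> cmod (e n - \<alpha> n * x)"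
    and contr: "\<And>n. cmod (c n) * cmod (\<alpha> n) \<le> \<kappa> * m\<^sup>2"
    and centre: "\<And>n. dist x0 (c n / (e n - \<alpha> n * x0)) \<le> (1 - \<kappa>) * \<rho>"
  shows "\<exists>r :: nat \<Rightarrow> complex. \<forall>n. r n \<in> cball x0 \<rho> \<and> r n = c n / (e n - \<alpha> n * r (Suc n))"
proof -
  define F where "F = (\<lambda>n x. c n / (e n - \<alpha> n * x))"
  have x0: "x0 \<in> cball x0 \<rho>" using \<rho> by simp
  have contrF: "dist (F n x) (F n y) \<le> \<kappa> * dist x y"
    if "x \<in> cball x0 \<rho>" "y \<in> cball x0 \<rho>" for n x y
    unfolding F_def by (rule dist_fractional_linear_le[OF m den[OF that(1)] den[OF that(2)] contr])
  have maps: "F n x \<in> cball x0 \<rho>" if "x \<in> cball x0 \<rho>" for n x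
  proof -
    have "dist x0 (F n x) \<le> dist x0 (F n x0) + dist (F n x0) (F n x)" by (rule dist_triangle)
    also have "\<dots> \<le> (1 - \<kappa>) * \<rho> + \<kappa> * dist x0 x"
      using centre[of n] contrF[OF x0 that, of n] by (simp add: F_def)
    also have "\<dots> \<le> (1 - \<kappa>) * \<rho> + \<kappa> * \<rho>"
      using that \<kappa> by (intro add_left_mono mult_left_mono) auto
    also have "\<dots> = \<rho>" by (simp add: algebra_simps)
    finally show ?thesis by simp
  qed
  have cb: "complete (cball x0 \<rho>)" "cball x0 \<rho> \<noteq> {}" using x0 by (auto simp: complete_eq_closed)
  show ?thesis
  proof (rule backward_orbit_exists[of "cball x0 \<rho>" \<kappa> F])
    fix r assume "\<And>n. r n \<in> cball x0 \<rho>" "\<And>n. r n = F n (r (Suc n))"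
    then have "\<forall>n. r n \<in> cball x0 \<rho> \<and> r n = c n / (e n - \<alpha> n * r (Suc n))"
      unfolding F_def by (intro allI conjI)
    then show ?thesis by (intro exI[of _ r])
  qed (fact cb bounded_cball \<kappa> maps contrF)+
qed

text \<open>
  The ratios \<open>r\<^sub>n = u\<^sub>n\<^sub>+\<^sub>1 / u\<^sub>n\<close> of a solution \<open>u\<close> of the recurrence satisfy
  \<open>r\<^sub>n = a\<^sub>n / (E - b\<^sub>n\<^sub>+\<^sub>1 - a\<^sub>n\<^sub>+\<^sub>1 r\<^sub>n\<^sub>+\<^sub>1)\<close>. As \<open>n \<rightarrow> \<infinity>\<close> the map on the right tends to
  \<open>x \<mapsto> 1/(E - x)\<close>, which fixes \<open>z\<close> and has derivative \<open>z\<^sup>2\<close> there. Hence far out the maps are uniform contractions of a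
  disc about \<open>z\<close>, and they have a backward orbit in it. The distance of this orbit to \<open>z\<close> is contracted
  at each backward step, up to the error \<open>\<eta>\<^sub>n\<close> with which the map fails to fix \<open>z\<close>, and so it tends to 0.
\<close>

lemma riccati_ratios_tendsto:
  fixes a b :: "nat \<Rightarrow> real" and z :: complex
  assumes pos: "\<And>n. a n > 0" and a: "a \<longlonglongrightarrow> 1" and b: "b \<longlonglongrightarrow> 0"
    and z: "z \<noteq> 0" "cmod z < 1"
  shows "\<exists>(r :: nat \<Rightarrow> complex) N. r \<longlonglongrightarrow> z \<and>
    (\<forall>n\<ge>N. r n * (z + inverse z - b (Suc n) - a (Suc n) * r (Suc n)) = a n)"
proof -
  define E where "E = z + inverse z"
  \<comment> \<open>At \<open>x = z\<close> the denominator tends to \<open>1/z\<close>, of modulus \<open>1 + 3 d\<close>. Moving \<open>x\<close> by at most \<open>d\<close> and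
    perturbing the coefficients by at most \<open>d\<close> leaves \<open>1 + d\<close>, and numerators \<open>a\<^sub>n a\<^sub>n\<^sub>+\<^sub>1 \<le> 1 + d\<close> then give the factor \<open>\<kappa>\<close>.\<close>
  define d where "d = (1 / cmod z - 1) / 3"
  define \<kappa> where "\<kappa> = 1 / (1 + d)"
  have d: "d > 0" using z by (simp add: d_def)
  have dz: "cmod (inverse z) = 1 + 3 * d"
    unfolding d_def by (simp only: norm_inverse inverse_eq_divide norm_divide norm_one) (simp add: diff_divide_distrib)
  have \<kappa>: "0 \<le> \<kappa>" "\<kappa> < 1" and \<kappa>m: "\<kappa> * (1 + d)\<^sup>2 = 1 + d"
    using d by (auto simp: \<kappa>_def power2_eq_square)
  define f where "f = (\<lambda>n x :: complex. complex_of_real (a n) / ((E - b (Suc n)) - a (Suc n) * x))"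
  define \<eta> where "\<eta> = (\<lambda>n. dist (f n z) z)"
  have a': "(\<lambda>n. a (Suc n)) \<longlonglongrightarrow> 1" and b': "(\<lambda>n. b (Suc n)) \<longlonglongrightarrow> 0"
    using a b by (auto intro: LIMSEQ_Suc)
  have ca: "(\<lambda>n. complex_of_real (a n)) \<longlonglongrightarrow> 1" and ca': "(\<lambda>n. complex_of_real (a (Suc n))) \<longlonglongrightarrow> 1"
    and cb': "(\<lambda>n. complex_of_real (b (Suc n))) \<longlonglongrightarrow> 0"
    using tendsto_of_real[OF a, where 'a = complex] tendsto_of_real[OF a', where 'a = complex]
      tendsto_of_real[OF b', where 'a = complex] by auto
  have "(\<lambda>n. f n z) \<longlonglongrightarrow> 1 / (E - 0 - 1 * z)"
    unfolding f_def by (intro tendsto_intros ca ca' cb') (use z in \<open>simp add: E_def\<close>)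
  then have "(\<lambda>n. f n z) \<longlonglongrightarrow> z" by (simp add: E_def divide_inverse)
  then have \<eta>: "\<eta> \<longlonglongrightarrow> 0"
    unfolding \<eta>_def by (rule tendsto_dist_iff[THEN iffD1])
  have "(\<lambda>n. \<bar>b (Suc n)\<bar> + \<bar>a (Suc n) - 1\<bar> * (cmod z + d)) \<longlonglongrightarrow> \<bar>0\<bar> + \<bar>1 - 1\<bar> * (cmod z + d)"
    by (intro tendsto_intros a' b')
  then have ev1: "\<forall>\<^sub>F n in sequentially. \<bar>b (Suc n)\<bar> + \<bar>a (Suc n) - 1\<bar> * (cmod z + d) < d"
    using d by (intro order_tendstoD(2)) auto
  have "(\<lambda>n. a n * a (Suc n)) \<longlonglongrightarrow> 1 * 1" by (intro tendsto_intros a a')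
  then have ev2: "\<forall>\<^sub>F n in sequentially. a n * a (Suc n) < 1 + d"
    using d by (intro order_tendstoD(2)) auto
  have ev3: "\<forall>\<^sub>F n in sequentially. \<eta> n < (1 - \<kappa>) * d"
    using d \<kappa> by (intro order_tendstoD(2)[OF \<eta>]) simp
  obtain N where N: "\<And>n. n \<ge> N \<Longrightarrow> \<bar>b (Suc n)\<bar> + \<bar>a (Suc n) - 1\<bar> * (cmod z + d) < d"
      "\<And>n. n \<ge> N \<Longrightarrow> a n * a (Suc n) < 1 + d" "\<And>n. n \<ge> N \<Longrightarrow> \<eta> n < (1 - \<kappa>) * d"
    using eventually_conj[OF ev1 eventually_conj[OF ev2 ev3]]
    unfolding eventually_sequentially by blast
  have den: "1 + d \<le> cmod ((E - b (Suc n)) - a (Suc n) * x)" if n: "n \<ge> N" and x: "x \<in> cball z d" for n and x :: complex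
  proof -
    have xz: "cmod (x - z) \<le> d" using x by (simp add: dist_norm norm_minus_commute)
    then have "cmod x \<le> cmod z + d" using norm_triangle_ineq2[of x z] by linarith
    then have "\<bar>a (Suc n) - 1\<bar> * cmod x \<le> \<bar>a (Suc n) - 1\<bar> * (cmod z + d)"
      by (intro mult_left_mono) auto
    moreover have "inverse z = ((E - b (Suc n)) - a (Suc n) * x) + (x - z) + b (Suc n)
        + complex_of_real (a (Suc n) - 1) * x"
      by (simp add: E_def algebra_simps)
    then have "cmod (inverse z) \<le> cmod ((E - b (Suc n)) - a (Suc n) * x) + cmod (x - z) + \<bar>b (Suc n)\<bar>
        + \<bar>a (Suc n) - 1\<bar> * cmod x"
      by (metis (no_types, lifting) norm_triangle_mono order_refl norm_mult norm_of_real)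
    ultimately show ?thesis using N(1)[OF n] xz unfolding dz by linarith
  qed
  have contr: "cmod (complex_of_real (a n)) * cmod (complex_of_real (a (Suc n))) \<le> \<kappa> * (1 + d)\<^sup>2"
    if "n \<ge> N" for n
    using N(2)[OF that] pos[of n] pos[of "Suc n"] by (simp add: \<kappa>m)
  have "\<exists>s :: nat \<Rightarrow> complex. \<forall>n. s n \<in> cball z d \<and>
      s n = a (N + n) / ((E - b (Suc (N + n))) - a (Suc (N + n)) * s (Suc n))"
  proof (rule fractional_linear_backward_orbit)
    show "1 + d > 0" "d \<ge> 0" using d by auto
    show "1 + d \<le> cmod (E - b (Suc (N + n)) - a (Suc (N + n)) * x)" if "x \<in> cball z d" for n and x :: complex
      using that by (intro den) auto
    show "cmod (complex_of_real (a (N + n))) * cmod (complex_of_real (a (Suc (N + n))))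
        \<le> \<kappa> * (1 + d)\<^sup>2" for n
      by (rule contr) simp
    show "dist z (complex_of_real (a (N + n)) / ((E - b (Suc (N + n))) - a (Suc (N + n)) * z))
        \<le> (1 - \<kappa>) * d" for n
      using N(3)[of "N + n"] by (simp add: \<eta>_def f_def dist_commute)
  qed (fact \<kappa>)+
  then obtain s :: "nat \<Rightarrow> complex" where s': "\<forall>n. s n \<in> cball z d \<and>
      s n = a (N + n) / ((E - b (Suc (N + n))) - a (Suc (N + n)) * s (Suc n))"
    by (rule exE)
  have s: "s n \<in> cball z d"
    "s n = a (N + n) / ((E - b (Suc (N + n))) - a (Suc (N + n)) * s (Suc n))" for n
    using s' by blast+
  define r where "r = (\<lambda>n. s (n - N))"
  have rd: "r n \<in> cball z d" for n unfolding r_def by (rule s(1))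
  have rf: "r n = f n (r (Suc n))" if "n \<ge> N" for n
    using s(2)[of "n - N"] that by (simp add: r_def f_def Suc_diff_le)
  have "(\<lambda>n. dist (r n) z) \<longlonglongrightarrow> 0"
  proof (rule backward_contraction_error_tendsto_0[OF \<kappa> _ _ _ \<eta>])
    show "dist (r n) z \<le> d" for n using rd[of n] by (simp add: dist_commute)
    show "\<forall>\<^sub>F n in sequentially. dist (r n) z \<le> \<kappa> * dist (r (Suc n)) z + \<eta> n"
    proof (rule eventually_sequentiallyI[of N])
      fix n assume n: "n \<ge> N"
      have "dist (f n (r (Suc n))) (f n z) \<le> \<kappa> * dist (r (Suc n)) z"
        unfolding f_def using d
        by (intro dist_fractional_linear_le[of "1 + d"] den[OF n] contr[OF n] rd) auto
      then show "dist (r n) z \<le> \<kappa> * dist (r (Suc n)) z + \<eta> n"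
        using dist_triangle[of "r n" z "f n z"] by (simp add: \<eta>_def rf[OF n])
    qed
  qed simp
  then have "r \<longlonglongrightarrow> z" by (rule tendsto_dist_iff[THEN iffD2])
  moreover have "r n * (z + inverse z - b (Suc n) - a (Suc n) * r (Suc n)) = a n" if "n \<ge> N" for n
  proof -
    have nz: "(E - b (Suc n)) - a (Suc n) * r (Suc n) \<noteq> 0" using den[OF that rd[of "Suc n"]] d by auto
    show "r n * (z + inverse z - b (Suc n) - a (Suc n) * r (Suc n)) = a n"
      unfolding E_def[symmetric] using nz by (subst rf[OF that]) (simp add: f_def)
  qed
  ultimately show ?thesis by (intro exI[of _ r] exI[of _ N]) simp
qed

text \<open>
  Beyond \<open>N\<close> the solution is the product of the ratios; as no \<open>a\<^sub>n\<close> vanishes, the recurrence can be solved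
  backward for the remaining values.
\<close>

lemma jacobi_solution_from_ratios:
  fixes a b :: "nat \<Rightarrow> real" and r :: "nat \<Rightarrow> complex" and E :: complex
  assumes pos: "\<And>n. a n > 0"
    and r: "\<forall>n\<ge>N. r n * (E - b (Suc n) - a (Suc n) * r (Suc n)) = a n"
  shows "\<exists>u. jacobi_solution a b E u \<and> (\<forall>n\<ge>N. u n = (\<Prod>k=N..<n. r k))"
proof -
  define G where "G = (\<lambda>n x (y :: complex). ((E - b (Suc n)) * x - a (Suc n) * y) / a n)"
  define v where "v = (\<lambda>n. \<Prod>k=N..<n. r k)"
  have vS: "v (Suc n) = r n * v n" if "n \<ge> N" for n using that by (simp add: v_def mult.commute)
  have "v n = G n (v (Suc n)) (v (Suc (Suc n)))" if n: "n \<ge> N" for n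
  proof -
    have "(E - b (Suc n)) * v (Suc n) - a (Suc n) * v (Suc (Suc n))
        = (r n * (E - b (Suc n) - a (Suc n) * r (Suc n))) * v n"
      using n by (simp add: vS algebra_simps)
    then show ?thesis using pos[of n] by (simp add: G_def r[rule_format, OF n])
  qed
  then obtain u where u: "\<forall>n\<ge>N. u n = v n" "\<forall>n. u n = G n (u (Suc n)) (u (Suc (Suc n)))"
    using backward_extension[of N v G] by blast
  have "jacobi_solution a b E u"
    unfolding jacobi_solution_def
  proof
    fix n
    have "u n = ((E - b (Suc n)) * u (Suc n) - a (Suc n) * u (Suc (Suc n))) / a n"
      using u(2) unfolding G_def by blast
    then have "a n * u n = (E - b (Suc n)) * u (Suc n) - a (Suc n) * u (Suc (Suc n))"
      using pos[of n] by (metis nonzero_mult_div_cancel_left of_real_eq_0_iff order_less_irrefl times_divide_eq_right)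
    then show "a (Suc n) * u (Suc (Suc n)) + b (Suc n) * u (Suc n) + a n * u n = E * u (Suc n)"
      by (simp add: algebra_simps)
  qed
  then show ?thesis using u(1) unfolding v_def by blast
qed

section \<open>The diagonal Green's function for \<open>z \<noteq> 0\<close>\<close>

text \<open>
  Shifted by one index, the orthonormal polynomials are the solution with initial values 0 and 1.
\<close>

lemma orth_poly_jacobi_solution:
  assumes pos: "\<And>n. n \<ge> 1 \<Longrightarrow> a n > 0"
  shows "jacobi_solution (a(0 := 1)) b E
    (\<lambda>n. case n of 0 \<Rightarrow> 0 | Suc k \<Rightarrow> poly (orth_poly a b k) E)"
  unfolding jacobi_solution_def
proof
  fix n
  show "complex_of_real ((a(0 := 1)) (Suc n)) * (case Suc (Suc n) of 0 \<Rightarrow> 0 | Suc k \<Rightarrow> poly (orth_poly a b k) E)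
      + b (Suc n) * (case Suc n of 0 \<Rightarrow> 0 | Suc k \<Rightarrow> poly (orth_poly a b k) E)
      + complex_of_real ((a(0 := 1)) n) * (case n of 0 \<Rightarrow> 0 | Suc k \<Rightarrow> poly (orth_poly a b k) E)
      = E * (case Suc n of 0 \<Rightarrow> 0 | Suc k \<Rightarrow> poly (orth_poly a b k) E)"
    using orth_poly_recurrence[of a n E b] pos[of "n + 1"] by (cases n) auto
qed

text \<open>
  The product is \<open>g\<^sub>n\<^sub>+\<^sub>1 / z\<close>, where \<open>g\<^sub>n = p\<^sub>n\<^sub>-\<^sub>1 w\<^sub>n\<close> is the diagonal Green's function. Let \<open>u\<close> be the solution
  with ratios \<open>r\<^sub>n \<rightarrow> z\<close>. It decays geometrically, so \<open>u\<^sub>0 = 0\<close> would make it an eigenvector; hence \<open>u\<^sub>0 \<noteq> 0\<close> and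
  \<open>w = u / u\<^sub>0\<close>. The Wronskian of \<open>p\<close> and \<open>w\<close> is 1, and replacing \<open>w\<^sub>n\<^sub>+\<^sub>1\<close> by \<open>r\<^sub>n w\<^sub>n\<close> in it
  gives \<open>g\<^sub>n\<^sub>+\<^sub>1 = r\<^sub>n\<^sup>2 g\<^sub>n + r\<^sub>n / a\<^sub>n\<close>. The limiting recursion has multiplier \<open>z\<^sup>2\<close> and fixed point \<open>z / (1 - z\<^sup>2)\<close>.
\<close>

lemma szego_jost_product_tendsto:
  fixes a b :: "nat \<Rightarrow> real" and z :: complex
  assumes pos: "\<And>n. n \<ge> 1 \<Longrightarrow> a n > 0" and a: "a \<longlonglongrightarrow> 1" and b: "b \<longlonglongrightarrow> 0"
    and z: "z \<noteq> 0" "cmod z < 1" and ne: "\<not> jacobi_eigenvalue a b (z + inverse z)"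
  shows "(\<lambda>n. szego_fun a b n z * jost_fun a b (Suc n) z) \<longlonglongrightarrow> 1 / (1 - z\<^sup>2)"
proof -
  define \<alpha> where "\<alpha> = a(0 := 1)"
  define E where "E = z + inverse z"
  have \<alpha>pos: "\<alpha> n > 0" for n using pos[of n] by (simp add: \<alpha>_def)
  have "\<forall>\<^sub>F n in sequentially. a n = \<alpha> n"
    using eventually_gt_at_top[of 0] by eventually_elim (simp add: \<alpha>_def)
  then have \<alpha>: "\<alpha> \<longlonglongrightarrow> 1" by (rule Lim_transform_eventually[OF a])
  obtain r :: "nat \<Rightarrow> complex" and N where r: "r \<longlonglongrightarrow> z"
    and ric: "\<forall>n\<ge>N. r n * (E - b (Suc n) - \<alpha> (Suc n) * r (Suc n)) = \<alpha> n"
    using riccati_ratios_tendsto[OF \<alpha>pos \<alpha> b z] unfolding E_def by (elim exE conjE)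
  from jacobi_solution_from_ratios[of \<alpha> N r E b, OF \<alpha>pos ric]
  obtain u where u: "jacobi_solution \<alpha> b E u" "\<forall>n\<ge>N. u n = (\<Prod>k=N..<n. r k)"
    by (elim exE conjE)
  have uS: "u (Suc n) = r n * u n" if "n \<ge> N" for n
    using u(2) that by (simp add: mult.commute)
  obtain q where q: "cmod z < q" "q < 1" using dense z(2) by blast
  have "\<forall>\<^sub>F n in sequentially. cmod (r n) < q" by (rule order_tendstoD(2)[OF tendsto_norm[OF r] q(1)])
  then obtain M where M: "\<And>n. n \<ge> M \<Longrightarrow> cmod (r n) < q" unfolding eventually_sequentially by blast
  have ratio: "cmod (u (Suc n)) \<le> q * cmod (u n)" if "n \<ge> max N M" for n
    using M[of n] that by (simp add: uS norm_mult mult_right_mono)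
  have u0: "u 0 \<noteq> 0"
  proof
    assume u0: "u 0 = 0"
    then have "u(0 := 0) = u" by (intro ext) simp
    then have "u \<in> ell2" using geometric_decay_imp_ell2(1)[of q "max N M" u, OF q(2) ratio] by simp
    moreover have "u N = 1" using u(2) by simp
    then have "u \<noteq> (\<lambda>n. 0)" by auto
    moreover have "jacobi_op a b u = (\<lambda>n. E * u n)"
    proof
      fix n show "jacobi_op a b u n = E * u n"
      proof (cases n)
        case 0 then show ?thesis by (simp add: jacobi_op_def u0)
      next
        case (Suc k)
        then show ?thesis
          using u(1)[unfolded jacobi_solution_def, rule_format, of k]
          by (simp add: jacobi_op_Suc[of u, OF u0] \<alpha>_def)
      qed
    qed
    ultimately show False using ne unfolding jacobi_eigenvalue_def E_def[symmetric] by blast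
  qed
  define w where "w = (\<lambda>n. u n / u 0)"
  have w: "jacobi_solution \<alpha> b E w"
    unfolding jacobi_solution_def
  proof
    fix n
    show "\<alpha> (Suc n) * w (Suc (Suc n)) + b (Suc n) * w (Suc n) + \<alpha> n * w n = E * w (Suc n)"
      using u(1)[unfolded jacobi_solution_def, rule_format, of n]
      by (simp add: w_def add_divide_distrib[symmetric])
  qed
  have w0: "w 0 = 1" using u0 by (simp add: w_def)
  have wratio: "cmod (w (Suc n)) \<le> q * cmod (w n)" if "n \<ge> max N M" for n
    using ratio[OF that] by (simp add: w_def norm_divide divide_right_mono)
  note w_dec = geometric_decay_imp_ell2[of q "max N M" w, OF q(2) wratio]
  obtain A where A: "\<And>n. a n \<le> A"
    using convergent_imp_Bseq[OF convergentI[OF a]] unfolding Bseq_def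
    by (metis abs_le_D1 real_norm_def)
  have weyl: "weyl a b n z = w n" if "n \<ge> 1" for n
    using weyl_eq_decaying_solution[OF pos A _ w0 w_dec that] w unfolding \<alpha>_def E_def by simp
  define p where "p = (\<lambda>n. case n of 0 \<Rightarrow> 0 | Suc k \<Rightarrow> poly (orth_poly a b k) E)"
  have p: "jacobi_solution \<alpha> b E p"
    unfolding p_def \<alpha>_def by (rule orth_poly_jacobi_solution[OF pos])
  define g where "g = (\<lambda>n. p n * w n)"
  have gS: "g (Suc n) = (r n)\<^sup>2 * g n + r n / \<alpha> n" if "n \<ge> N" for n
  proof -
    have wS: "w (Suc n) = r n * w n" using uS[OF that] by (simp add: w_def)
    have "\<alpha> n * (p (Suc n) * w n - p n * w (Suc n)) = 1"
      using jacobi_solution_wronskian[OF p w, of n] w0 by (simp add: p_def \<alpha>_def)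
    then have "p (Suc n) * w n - p n * w (Suc n) = 1 / \<alpha> n"
      using \<alpha>pos[of n] by (simp add: eq_divide_eq mult.commute)
    then have "p (Suc n) * w n = p n * (r n * w n) + 1 / \<alpha> n" by (simp add: wS algebra_simps)
    moreover have "g (Suc n) = r n * (p (Suc n) * w n)" by (simp add: g_def wS)
    ultimately show ?thesis by (simp add: g_def power2_eq_square algebra_simps)
  qed
  have c\<alpha>: "(\<lambda>n. complex_of_real (\<alpha> n)) \<longlonglongrightarrow> 1"
    using tendsto_of_real[OF \<alpha>, where 'a = complex] by simp
  have "cmod (z\<^sup>2) < 1" using z by (simp add: norm_power power_less_one_iff abs_square_less_1)
  moreover have "(\<lambda>n. (r n)\<^sup>2) \<longlonglongrightarrow> z\<^sup>2" by (intro tendsto_intros r)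
  moreover have "(\<lambda>n. r n / \<alpha> n) \<longlonglongrightarrow> z / 1" by (intro tendsto_intros r c\<alpha>) simp
  moreover have "\<forall>\<^sub>F n in sequentially. g (Suc n) = (r n)\<^sup>2 * g n + r n / \<alpha> n"
    using gS by (rule eventually_sequentiallyI)
  ultimately have "g \<longlonglongrightarrow> z / 1 / (1 - z\<^sup>2)"
    by (intro affine_recursion_tendsto[of "\<lambda>n. (r n)\<^sup>2" "z\<^sup>2" "\<lambda>n. r n / \<alpha> n" "z / 1" g])
  from tendsto_divide[OF LIMSEQ_Suc[OF this] tendsto_const z(1)]
  have "(\<lambda>n. g (Suc n) / z) \<longlonglongrightarrow> z / 1 / (1 - z\<^sup>2) / z" .
  moreover have "g (Suc n) / z = szego_fun a b n z * jost_fun a b (Suc n) z" for n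
  proof -
    have zp: "z ^ n * z powi (- int (Suc n)) = inverse z"
      using z(1) by (simp only: power_int_minus power_int_of_nat) simp
    have "szego_fun a b n z * jost_fun a b (Suc n) z
        = (z ^ n * z powi (- int (Suc n))) * (p (Suc n) * w (Suc n))"
      using z(1) weyl[of "Suc n"]
      by (simp only: szego_fun_def jost_fun_def Let_def p_def E_def if_False nat.case) simp
    then show ?thesis unfolding zp by (simp add: g_def divide_inverse)
  qed
  ultimately show ?thesis using z(1) by simp
qed

section \<open>The point \<open>z = 0\<close>\<close>

text \<open>
  After multiplication by \<open>z\<^sup>n\<^sup>+\<^sup>1\<close> the recurrence of the orthonormal polynomials reads
  \<open>a\<^sub>n\<^sub>+\<^sub>1 S\<^sub>n\<^sub>+\<^sub>1 = (z\<^sup>2 + 1 - b\<^sub>n\<^sub>+\<^sub>1 z) S\<^sub>n - z\<^sup>2 a\<^sub>n S\<^sub>n\<^sub>-\<^sub>1\<close>, and at \<open>z = 0\<close> only \<open>S\<^sub>n\<close> survives on the right.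
\<close>

lemma szego_fun_0:
  assumes pos: "\<And>n. n \<ge> 1 \<Longrightarrow> a n > 0"
  shows "szego_fun a b n 0 = 1 / (\<Prod>k<Suc n. complex_of_real ((a(0 := 1)) k))"
proof -
  define S where "S = (\<lambda>n (z :: complex). z ^ n * poly (orth_poly a b n) (z + inverse z))"
  define P where "P = (\<lambda>n. 1 / (\<Prod>k<Suc n. complex_of_real ((a(0 := 1)) k)))"
  have PS: "P (Suc n) = P n / a (Suc n)" for n by (simp add: P_def)
  have rec: "S (Suc n) z = ((z\<^sup>2 + 1 - b (Suc n) * z) * S n z
      - z\<^sup>2 * (if n = 0 then 0 else a n * S (n - 1) z)) / a (Suc n)" if z: "z \<noteq> 0" for n and z :: complex
  proof -
    define E where "E = z + inverse z"
    have SE: "S m z = z ^ m * poly (orth_poly a b m) E" for m by (simp add: S_def E_def)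
    have zE: "z * E = z\<^sup>2 + 1" using z by (simp add: E_def power2_eq_square algebra_simps)
    have "a (n + 1) * poly (orth_poly a b (n + 1)) E
        = (E - b (n + 1)) * poly (orth_poly a b n) E
          - (if n = 0 then 0 else a n * poly (orth_poly a b (n - 1)) E)"
      using orth_poly_recurrence[of a n E b] pos[of "n + 1"] by (simp add: algebra_simps)
    then have "a (Suc n) * S (Suc n) z = z ^ Suc n * ((E - b (Suc n)) * poly (orth_poly a b n) E
          - (if n = 0 then 0 else a n * poly (orth_poly a b (n - 1)) E))"
      by (simp add: SE mult.left_commute)
    also have "\<dots> = (z * E - b (Suc n) * z) * S n z - z\<^sup>2 * (if n = 0 then 0 else a n * S (n - 1) z)"
      by (cases n) (simp_all add: SE power2_eq_square algebra_simps)
    finally show ?thesis using pos[of "Suc n"] unfolding zE by (simp add: eq_divide_eq mult.commute)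
  qed
  have "(S n \<longlongrightarrow> P n) (at 0)" for n
  proof (induction n rule: less_induct)
    case (less n)
    show ?case
    proof (cases n)
      case 0
      then show ?thesis by (simp add: S_def P_def)
    next
      case (Suc m)
      \<comment> \<open>For \<open>m = 0\<close> the recurrence has no second term, and \<open>T\<close> covers both cases; it only has to converge, as it is multiplied by \<open>z\<^sup>2 \<rightarrow> 0\<close>.\<close>
      define T where "T = (\<lambda>z :: complex. if m = 0 then 0 else a m * S (m - 1) z)"
      have "\<exists>t. (T \<longlongrightarrow> t) (at 0)"
      proof (cases "m = 0")
        case True
        then show ?thesis by (auto simp: T_def)
      next
        case False
        then have "((\<lambda>z. a m * S (m - 1) z) \<longlongrightarrow> a m * P (m - 1)) (at 0)"
          using Suc by (intro tendsto_intros less.IH) simp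
        with False show ?thesis by (auto simp: T_def)
      qed
      then obtain t where t: "(T \<longlongrightarrow> t) (at 0)" by blast
      have Sm: "(S m \<longlongrightarrow> P m) (at 0)" using Suc by (intro less.IH) simp
      have "((\<lambda>z :: complex. ((z\<^sup>2 + 1 - b (Suc m) * z) * S m z - z\<^sup>2 * T z) / a (Suc m))
          \<longlongrightarrow> ((0\<^sup>2 + 1 - b (Suc m) * (0 :: complex)) * P m - 0\<^sup>2 * t) / a (Suc m)) (at 0)"
        using pos[of "Suc m"] by (intro tendsto_intros Sm t) simp
      then have "((\<lambda>z :: complex. ((z\<^sup>2 + 1 - b (Suc m) * z) * S m z - z\<^sup>2 * T z) / a (Suc m)) \<longlongrightarrow> P n) (at 0)"
        by (simp add: Suc PS)
      moreover have "\<forall>\<^sub>F z :: complex in at 0. ((z\<^sup>2 + 1 - b (Suc m) * z) * S m z - z\<^sup>2 * T z) / a (Suc m) = S n z"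
        using rec[of _ m] by (auto simp: eventually_at_filter T_def Suc)
      ultimately show ?thesis by (rule Lim_transform_eventually)
    qed
  qed
  then have "Lim (at 0) (S n) = P n" by (intro tendsto_Lim) auto
  then show ?thesis by (simp only: szego_fun_def S_def P_def Let_def if_True simp_thms)
qed

text \<open>
  For large \<open>E\<close> all the maps \<open>x \<mapsto> a\<^sub>n / (E - b\<^sub>n\<^sub>+\<^sub>1 - a\<^sub>n\<^sub>+\<^sub>1 x)\<close>, from \<open>n = 0\<close> on, contract the closed unit disc
  into itself. The resulting solution is the product of the ratios from the start, with \<open>w\<^sub>0 = 1\<close>, so it is the
  Weyl solution. The threshold \<open>3 A + B\<close> keeps the denominators at least \<open>2 A\<close>, which gives ratios of modulus at
  most \<open>1/2\<close> and contraction factor \<open>1/4\<close>.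
\<close>

lemma weyl_eq_prod_ratios:
  fixes a b :: "nat \<Rightarrow> real" and z :: complex
  assumes pos: "\<And>n. n \<ge> 1 \<Longrightarrow> a n > 0"
    and A: "\<And>n. \<bar>(a(0 := 1)) n\<bar> \<le> A" "A \<ge> 1" and B: "\<And>n. \<bar>b n\<bar> \<le> B"
    and large: "cmod (z + inverse z) \<ge> 3 * A + B"
  shows "\<exists>r :: nat \<Rightarrow> complex. \<forall>n. cmod (r n) \<le> 1 \<and>
    r n = (a(0 := 1)) n / (z + inverse z - b (Suc n) - a (Suc n) * r (Suc n)) \<and>
    (n \<ge> 1 \<longrightarrow> weyl a b n z = (\<Prod>k<n. r k))"
proof -
  define \<alpha> where "\<alpha> = a(0 := 1)"
  define E where "E = z + inverse z"
  have \<alpha>pos: "\<alpha> n > 0" for n using pos[of n] by (simp add: \<alpha>_def)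
  have \<alpha>A: "\<bar>\<alpha> n\<bar> \<le> A" for n using A(1)[of n] by (simp only: \<alpha>_def)
  have den: "2 * A \<le> cmod (E - b (Suc n) - \<alpha> (Suc n) * x)" if "x \<in> cball 0 1" for n and x :: complex
  proof -
    have "\<bar>\<alpha> (Suc n)\<bar> * cmod x \<le> A * 1" using \<alpha>A[of "Suc n"] that A(2) by (intro mult_mono) auto
    moreover have "cmod E \<le> cmod (E - b (Suc n) - \<alpha> (Suc n) * x) + \<bar>b (Suc n)\<bar> + \<bar>\<alpha> (Suc n)\<bar> * cmod x"
      using norm_triangle_ineq2[of "E - b (Suc n)" "\<alpha> (Suc n) * x"] norm_triangle_ineq2[of E "b (Suc n)"]
      by (simp add: norm_mult)
    ultimately show ?thesis using large B[of "Suc n"] unfolding E_def[symmetric] by linarith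
  qed
  have \<alpha>\<alpha>: "cmod (complex_of_real (\<alpha> n)) * cmod (complex_of_real (\<alpha> (Suc n))) \<le> 1 / 4 * (2 * A)\<^sup>2" for n
  proof -
    have "\<bar>\<alpha> n\<bar> * \<bar>\<alpha> (Suc n)\<bar> \<le> A * A" using \<alpha>A A(2) by (intro mult_mono) auto
    then show ?thesis by (simp add: power2_eq_square)
  qed
  have half: "cmod (\<alpha> n / (E - b (Suc n) - \<alpha> (Suc n) * x)) \<le> 1 / 2" if "x \<in> cball 0 1" for n and x :: complex
  proof -
    have "cmod (\<alpha> n / (E - b (Suc n) - \<alpha> (Suc n) * x)) \<le> A / (2 * A)"
      unfolding norm_divide using \<alpha>A[of n] den[OF that, of n] A(2) by (intro frac_le) auto
    then show ?thesis using A(2) by simp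
  qed
  have "\<exists>r :: nat \<Rightarrow> complex. \<forall>n. r n \<in> cball 0 1 \<and> r n = \<alpha> n / (E - b (Suc n) - \<alpha> (Suc n) * r (Suc n))"
  proof (rule fractional_linear_backward_orbit)
    show "2 * A \<le> cmod (E - b (Suc n) - \<alpha> (Suc n) * x)" if "x \<in> cball 0 1" for n and x :: complex
      by (rule den[OF that])
    show "cmod (complex_of_real (\<alpha> n)) * cmod (complex_of_real (\<alpha> (Suc n))) \<le> 1 / 4 * (2 * A)\<^sup>2" for n
      by (rule \<alpha>\<alpha>)
    show "dist 0 (complex_of_real (\<alpha> n) / (E - b (Suc n) - \<alpha> (Suc n) * (0 :: complex))) \<le> (1 - 1 / 4) * 1" for n
      using half[of 0 n] by (simp only: dist_0_norm) simp
  qed (use A(2) in auto)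
  then obtain r :: "nat \<Rightarrow> complex" where
    r: "\<forall>n. r n \<in> cball 0 1 \<and> r n = \<alpha> n / (E - b (Suc n) - \<alpha> (Suc n) * r (Suc n))"
    by (rule exE)
  have rb: "r n \<in> cball 0 1" for n using r by blast
  have rf: "r n = \<alpha> n / (E - b (Suc n) - \<alpha> (Suc n) * r (Suc n))" for n using r by blast
  have rh: "cmod (r n) \<le> 1 / 2" for n by (subst rf) (rule half[OF rb])
  have "\<forall>n\<ge>0. r n * (E - b (Suc n) - \<alpha> (Suc n) * r (Suc n)) = \<alpha> n"
  proof (intro allI impI)
    fix n
    have "E - b (Suc n) - \<alpha> (Suc n) * r (Suc n) \<noteq> 0" using den[OF rb[of "Suc n"], of n] A(2) by auto
    then show "r n * (E - b (Suc n) - \<alpha> (Suc n) * r (Suc n)) = \<alpha> n" by (subst rf) simp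
  qed
  from jacobi_solution_from_ratios[of \<alpha> 0 r E b, OF \<alpha>pos this]
  obtain w where w: "jacobi_solution \<alpha> b E w" "\<forall>n\<ge>0. w n = (\<Prod>k=0..<n. r k)"
    by (elim exE conjE)
  have wp: "w n = (\<Prod>k<n. r k)" for n using w(2) by (simp add: atLeast0LessThan)
  have ratio: "cmod (w (Suc n)) \<le> 1 / 2 * cmod (w n)" if "n \<ge> 0" for n
    using mult_right_mono[OF rh[of n] norm_ge_zero[of "w n"]] by (simp add: wp norm_mult mult.commute)
  note w_dec = geometric_decay_imp_ell2[of "1 / 2" 0 w, OF _ ratio]
  have bd: "a n \<le> max A (a 0)" for n using A(1)[of n] by (cases n) auto
  have w0: "w 0 = 1" by (simp add: wp)
  have "weyl a b n z = w n" if "n \<ge> 1" for n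
    using weyl_eq_decaying_solution[OF pos bd _ w0 w_dec that] w(1) unfolding \<alpha>_def E_def by simp
  then have "weyl a b n z = (\<Prod>k<n. r k)" if "n \<ge> 1" for n
    using that by (simp add: wp)
  moreover have "cmod (r n) \<le> 1" for n using rh[of n] by linarith
  moreover have "r n = (a(0 := 1)) n / (z + inverse z - b (Suc n) - a (Suc n) * r (Suc n))" for n
    using rf[of n] unfolding \<alpha>_def E_def by simp
  ultimately show ?thesis by (intro exI[of _ r] allI conjI impI)
qed

text \<open>
  Near \<open>z = 0\<close> the Weyl solution is a product of ratios \<open>r\<^sub>k(z)\<close>, for \<open>k < n\<close>, that are bounded by 1. Since
  \<open>z (z + 1/z - b\<^sub>k\<^sub>+\<^sub>1 - a\<^sub>k\<^sub>+\<^sub>1 r\<^sub>k\<^sub>+\<^sub>1(z)) \<rightarrow> 1\<close>, each factor satisfies \<open>r\<^sub>k(z) / z \<rightarrow> a\<^sub>k\<close>, with \<open>a\<^sub>0 = 1\<close>.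
\<close>

lemma jost_fun_0:
  fixes a b :: "nat \<Rightarrow> real"
  assumes pos: "\<And>n. n \<ge> 1 \<Longrightarrow> a n > 0" and "Bseq a" "Bseq b" and n: "n \<ge> 1"
  shows "jost_fun a b n 0 = (\<Prod>k<n. complex_of_real ((a(0 := 1)) k))"
proof -
  obtain A0 B where AB: "\<And>n. \<bar>a n\<bar> \<le> A0" "\<And>n. \<bar>b n\<bar> \<le> B"
    using assms(2,3) unfolding Bseq_def by (metis real_norm_def)
  define A where "A = max 1 A0"
  have A: "\<bar>(a(0 := 1)) n\<bar> \<le> A" "\<bar>a n\<bar> \<le> A" "A \<ge> 1" for n using AB(1)[of n] by (auto simp: A_def)
  have B0: "B \<ge> 0" using AB(2)[of 0] by linarith
  \<comment> \<open>If \<open>0 < |z| < \<delta> \<le> 1\<close>, then \<open>|z + 1/z| \<ge> 1/|z| - 1 \<ge> 3 A + B\<close>.\<close>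
  define \<delta> where "\<delta> = 1 / (3 * A + B + 1)"
  have \<delta>: "\<delta> > 0" "\<delta> \<le> 1" using A(3) B0 by (auto simp: \<delta>_def)
  define D where "D = (\<lambda>z :: complex. z \<noteq> 0 \<and> cmod z < \<delta>)"
  have evD: "\<forall>\<^sub>F z :: complex in at 0. D z"
    unfolding eventually_at D_def using \<delta>(1) by (intro exI[of _ \<delta>]) auto
  have large: "cmod (z + inverse z) \<ge> 3 * A + B" if "D z" for z :: complex
  proof -
    have "1 / \<delta> \<le> 1 / cmod z" using that \<delta>(1) by (intro divide_left_mono) (auto simp: D_def)
    then have "3 * A + B + 1 \<le> cmod (inverse z)" by (simp add: \<delta>_def norm_divide inverse_eq_divide)
    moreover have "cmod z < 1" using that \<delta>(2) by (simp add: D_def)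
    ultimately show ?thesis using norm_triangle_ineq2[of "inverse z" "- z"] by (simp add: add.commute)
  qed
  have "\<forall>z :: complex. \<exists>r :: nat \<Rightarrow> complex. D z \<longrightarrow> (\<forall>n. cmod (r n) \<le> 1 \<and>
      r n = (a(0 := 1)) n / (z + inverse z - b (Suc n) - a (Suc n) * r (Suc n)) \<and>
      (n \<ge> 1 \<longrightarrow> weyl a b n z = (\<Prod>k<n. r k)))"
  proof
    fix z :: complex
    show "\<exists>r :: nat \<Rightarrow> complex. D z \<longrightarrow> (\<forall>n. cmod (r n) \<le> 1 \<and>
      r n = (a(0 := 1)) n / (z + inverse z - b (Suc n) - a (Suc n) * r (Suc n)) \<and>
      (n \<ge> 1 \<longrightarrow> weyl a b n z = (\<Prod>k<n. r k)))"
    proof (cases "D z")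
      case True
      have "\<exists>r :: nat \<Rightarrow> complex. (\<forall>n. cmod (r n) \<le> 1 \<and>
      r n = (a(0 := 1)) n / (z + inverse z - b (Suc n) - a (Suc n) * r (Suc n)) \<and>
      (n \<ge> 1 \<longrightarrow> weyl a b n z = (\<Prod>k<n. r k)))"
        by (rule weyl_eq_prod_ratios[OF _ A(1) A(3) AB(2) large[OF True]]) (rule pos)
      then show ?thesis by (elim exE) (intro exI impI)
    qed simp
  qed
  from choice[OF this] obtain r :: "complex \<Rightarrow> nat \<Rightarrow> complex" where
    r: "\<forall>z :: complex. D z \<longrightarrow> (\<forall>n. cmod (r z n) \<le> 1 \<and>
      r z n = (a(0 := 1)) n / (z + inverse z - b (Suc n) - a (Suc n) * r z (Suc n)) \<and>
      (n \<ge> 1 \<longrightarrow> weyl a b n z = (\<Prod>k<n. r z k)))"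
    by (rule exE)
  have lim: "((\<lambda>z :: complex. r z k / z) \<longlongrightarrow> complex_of_real ((a(0 := 1)) k)) (at 0)" for k
  proof -
    define h where "h = (\<lambda>z :: complex. z * (b (Suc k) + a (Suc k) * r z (Suc k)))"
    have "((\<lambda>z :: complex. cmod z * (B + A)) \<longlongrightarrow> cmod 0 * (B + A)) (at (0 :: complex))" by (intro tendsto_intros)
    then have "((\<lambda>z :: complex. cmod z * (B + A)) \<longlongrightarrow> 0) (at 0)" by simp
    moreover have "\<forall>\<^sub>F z :: complex in at 0. cmod (h z) \<le> cmod z * (B + A)"
      using evD
    proof eventually_elim
      case (elim z)
      have "cmod (r z (Suc k)) \<le> 1" using r elim by blast
      then have "\<bar>a (Suc k)\<bar> * cmod (r z (Suc k)) \<le> A * 1" using A(2,3) by (intro mult_mono) auto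
      then have "cmod (b (Suc k) + a (Suc k) * r z (Suc k)) \<le> B + A"
        using norm_triangle_ineq[of "complex_of_real (b (Suc k))" "a (Suc k) * r z (Suc k)"] AB(2)[of "Suc k"]
        by (simp add: norm_mult)
      then show ?case unfolding h_def norm_mult by (intro mult_left_mono) auto
    qed
    ultimately have h: "(h \<longlongrightarrow> 0) (at 0)" by (rule Lim_null_comparison[rotated])
    have "((\<lambda>z :: complex. (a(0 := 1)) k / (z\<^sup>2 + 1 - h z)) \<longlongrightarrow> (a(0 := 1)) k / (0\<^sup>2 + 1 - 0 :: complex)) (at 0)"
      by (intro tendsto_intros h) simp
    moreover have "\<forall>\<^sub>F z :: complex in at 0. (a(0 := 1)) k / (z\<^sup>2 + 1 - h z) = r z k / z"
      using evD
    proof eventually_elim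
      case (elim z)
      then have z: "z \<noteq> 0" by (simp add: D_def)
      have "r z k = (a(0 := 1)) k / (z + inverse z - b (Suc k) - a (Suc k) * r z (Suc k))"
        using r elim by blast
      then have "r z k / z = (a(0 := 1)) k / ((z + inverse z - b (Suc k) - a (Suc k) * r z (Suc k)) * z)"
        by (metis divide_divide_eq_left)
      also have "(z + inverse z - b (Suc k) - a (Suc k) * r z (Suc k)) * z = z\<^sup>2 + 1 - h z"
        using z by (simp add: h_def power2_eq_square algebra_simps)
      finally show ?case by (rule sym)
    qed
    ultimately show ?thesis using Lim_transform_eventually by fastforce
  qed
  have "((\<lambda>z :: complex. \<Prod>k<n. r z k / z) \<longlongrightarrow> (\<Prod>k<n. complex_of_real ((a(0 := 1)) k))) (at 0)"
    by (intro tendsto_prod lim)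
  moreover have "\<forall>\<^sub>F z :: complex in at 0. (\<Prod>k<n. r z k / z) = z powi (- int n) * weyl a b n z"
    using evD
  proof eventually_elim
    case (elim z)
    have "weyl a b n z = (\<Prod>k<n. r z k)" using r elim n by blast
    moreover have "(\<Prod>k<n. r z k / z) = (\<Prod>k<n. r z k) / z ^ n" by (simp add: prod_dividef)
    ultimately show ?case by (simp add: power_int_minus divide_inverse mult.commute)
  qed
  ultimately have "((\<lambda>z :: complex. z powi (- int n) * weyl a b n z) \<longlongrightarrow> (\<Prod>k<n. complex_of_real ((a(0 := 1)) k))) (at 0)"
    by (rule Lim_transform_eventually)
  then have "Lim (at 0) (\<lambda>z :: complex. z powi (- int n) * weyl a b n z) = (\<Prod>k<n. complex_of_real ((a(0 := 1)) k))"
    by (intro tendsto_Lim) auto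
  then show ?thesis by (simp only: jost_fun_def Let_def if_True simp_thms)
qed

section \<open>Equivalence of the two asymptotics\<close>

theorem theorem1p7:
  fixes a b :: "nat \<Rightarrow> real" and z0 :: complex
  assumes "\<And>n. n \<ge> 1 \<Longrightarrow> a n > 0"
    and "a \<longlonglongrightarrow> 1"
    and "b \<longlonglongrightarrow> 0"
    and "cmod z0 < 1"
    and "z0 \<noteq> 0 \<Longrightarrow> \<not> jacobi_eigenvalue a b (z0 + inverse z0)"
  shows "szego_asymptotics_at a b z0 \<longleftrightarrow> jost_asymptotics_at a b z0"
proof -
  have "\<exists>c. c \<noteq> 0 \<and> (\<lambda>n. szego_fun a b n z0 * jost_fun a b (Suc n) z0) \<longlonglongrightarrow> c"
  proof (cases "z0 = 0")
    case True
    have bs: "Bseq a" "Bseq b"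
      using convergent_imp_Bseq[OF convergentI[OF assms(2)]] convergent_imp_Bseq[OF convergentI[OF assms(3)]] .
    have "szego_fun a b n z0 * jost_fun a b (Suc n) z0 = 1" for n
    proof -
      define P where "P = (\<Prod>k<Suc n. complex_of_real ((a(0 := 1)) k))"
      have "P \<noteq> 0" using assms(1) by (auto simp: P_def less_imp_neq[symmetric])
      moreover have "szego_fun a b n z0 = 1 / P"
        unfolding True P_def by (rule szego_fun_0) (rule assms(1))
      moreover have "jost_fun a b (Suc n) z0 = P"
        unfolding True P_def by (rule jost_fun_0[OF _ bs]) (simp_all add: assms(1))
      ultimately show ?thesis by simp
    qed
    then show ?thesis by (intro exI[of _ 1]) simp
  next
    case False
    have "cmod (z0\<^sup>2) < 1" using assms(4) by (simp add: norm_power abs_square_less_1)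
    then have "1 / (1 - z0\<^sup>2) \<noteq> 0" by auto
    then show ?thesis
      using szego_jost_product_tendsto[OF assms(1-3) False assms(4,5)] False by blast
  qed
  then obtain c where "c \<noteq> 0" "(\<lambda>n. szego_fun a b n z0 * jost_fun a b (Suc n) z0) \<longlonglongrightarrow> c" by blast
  from tendsto_nonzero_iff_cofactor[of "\<lambda>n. szego_fun a b n z0" "\<lambda>n. jost_fun a b n z0", OF this(2,1)]
  show ?thesis by (simp only: szego_asymptotics_at_def jost_asymptotics_at_def)
qed

end
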